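(* Let $\Phi\in\mathbb{R}^{N\times n}$ have orthonormal columns, let $S\in\mathbb{R}^{N\times k}$ be a selection matrix, and let $\Gamma_{\mathrm{prior}}\in\mathbb{R}^{n\times n}$ and $\Gamma_{\mathrm{noise}}\in\mathbb{R}^{k\times k}$ be symmetric positive definite matrices. Let $u\in\mathbb{R}^N$ with $u\ne 0$, let $\eta\in\mathbb{R}^k$ be the measurement noise, and let $y=S^\top u+\eta$. Let $$\Gamma_{\mathrm{post}}:=\left(\Gamma_{\mathrm{prior}}^{-1}+(S^\top\Phi)^\top\Gamma_{\mathrm{noise}}^{-1}(S^\top\Phi)\right)^{-1},\qquad u_{\mathrm{MAP}}:=\Phi\,\Gamma_{\mathrm{post}}(S^\top\Phi)^\top\Gamma_{\mathrm{noise}}^{-1}y,$$ and let $D:=\Phi\,\Gamma_{\mathrm{post}}(S^\top\Phi)^\top\Gamma_{\mathrm{noise}}^{-1}S^\top$. Then $$\frac{\|u_{\mathrm{MAP}}-u\|_2}{\|u\|_2}\le \|D-I\|_2+\left\|\Gamma_{\mathrm{post}}(S^\top\Phi)^\top\Gamma_{\mathrm{noise}}^{-1}\right\|_2\,\frac{\|\eta\|_2}{\|u\|_2}.$$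
   Context: A selection matrix $S\in\mathbb{R}^{N\times k}$ is a matrix whose columns are $k$ distinct columns of the $N\times N$ identity matrix. $\|\cdot\|_2$ is the Euclidean norm for vectors and the spectral (operator) norm for matrices; $I$ is the $N\times N$ identity matrix. *)

theory Defs
  imports "HOL-Analysis.Analysis"
begin

(* A real N x k matrix (N rows, k columns) has type real^'k^'N. *)

definition selection_matrix :: "real^'k^'N \<Rightarrow> bool" where
  "selection_matrix S \<longleftrightarrow>
     (\<exists>p :: 'k \<Rightarrow> 'N. inj p \<and> (\<forall>j. column j S = column (p j) (mat 1 :: real^'N^'N)))"

(* Stated for the indexed family of columns; the set "columns A" would identify equal columns. *)
definition orthonormal_columns :: "real^'n^'N \<Rightarrow> bool" where
  "orthonormal_columns A \<longleftrightarrow>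
     (\<forall>j. norm (column j A) = 1) \<and>
     (\<forall>i j. i \<noteq> j \<longrightarrow> orthogonal (column i A) (column j A))"

definition sym_pos_def :: "real^'n^'n \<Rightarrow> bool" where
  "sym_pos_def A \<longleftrightarrow> transpose A = A \<and> (\<forall>x. x \<noteq> 0 \<longrightarrow> x \<bullet> (A *v x) > 0)"

(* The library's norm on real^'m^'n is the Frobenius norm, so the matrix 2-norm
   has to be taken as the operator norm of the induced linear map. *)
definition spectral_norm :: "real^'m^'n \<Rightarrow> real" where
  "spectral_norm A = onorm (\<lambda>x. A *v x)"

definition Gamma_post ::
  "real^'n^'N \<Rightarrow> real^'k^'N \<Rightarrow> real^'n^'n \<Rightarrow> real^'k^'k \<Rightarrow> real^'n^'n" where
  "Gamma_post \<Phi> S \<Gamma>prior \<Gamma>noise =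
     matrix_inv (matrix_inv \<Gamma>prior +
       transpose (transpose S ** \<Phi>) ** matrix_inv \<Gamma>noise ** (transpose S ** \<Phi>))"

definition u_MAP ::
  "real^'n^'N \<Rightarrow> real^'k^'N \<Rightarrow> real^'n^'n \<Rightarrow> real^'k^'k \<Rightarrow> real^'k \<Rightarrow> real^'N" where
  "u_MAP \<Phi> S \<Gamma>prior \<Gamma>noise y =
     (\<Phi> ** Gamma_post \<Phi> S \<Gamma>prior \<Gamma>noise ** transpose (transpose S ** \<Phi>)
        ** matrix_inv \<Gamma>noise) *v y"

end

theory Submission
  imports Defs
begin

text \<open>
  Write \<open>D = \<Phi> ** B ** S\<^sup>T\<close> with \<open>B = \<Gamma>post ** (S\<^sup>T ** \<Phi>)\<^sup>T ** \<Gamma>noise\<inverse>\<close>. The MAP estimate is linear in the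
  data, so inserting \<open>y = S\<^sup>T u + \<eta>\<close> splits its error exactly into a deterministic and a noise part:
  \<open>u_MAP - u = (D - I) u + \<Phi> (B \<eta>)\<close>.
  The first part is at most \<open>\<parallel>D - I\<parallel> \<parallel>u\<parallel>\<close>. Since \<open>\<Phi>\<close> has orthonormal columns it is an isometry,
  so it can be dropped from the norm of the second part, which is then at most \<open>\<parallel>B\<parallel> \<parallel>\<eta>\<parallel>\<close>.
  Dividing by \<open>\<parallel>u\<parallel>\<close> gives the bound.
\<close>

lemma norm_matrix_vector_le_spectral_norm:
  fixes A :: "real^'m^'n"
  shows "norm (A *v x) \<le> spectral_norm A * norm x"
  unfolding spectral_norm_def by (intro onorm matrix_vector_mul_bounded_linear)

text \<open>The Gram matrix of orthonormal columns is the identity, so the map preserves inner products.\<close>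

lemma norm_orthonormal_columns_mult:
  fixes A :: "real^'n^'N"
  assumes "orthonormal_columns A"
  shows "norm (A *v x) = norm x"
proof -
  have "transpose A ** A = mat 1"
    using assms
    by (auto simp: matrix_mult_transpose_dot_column orthonormal_columns_def vec_eq_iff mat_def
        orthogonal_def norm_eq_1)
  then have "(A *v x) \<bullet> (A *v x) = x \<bullet> x"
    by (metis dot_lmul_matrix matrix_vector_mul_assoc matrix_vector_mul_lid
        transpose_matrix_vector transpose_transpose)
  then show ?thesis
    by (simp add: norm_eq_sqrt_inner)
qed

theorem proposition3p1:
  fixes \<Phi> :: "real^'n^'N"
    and S :: "real^'k^'N"
    and \<Gamma>prior :: "real^'n^'n"
    and \<Gamma>noise :: "real^'k^'k"
    and u :: "real^'N"
    and \<eta> y :: "real^'k"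
    and D :: "real^'N^'N"
  assumes "orthonormal_columns \<Phi>"
    and "selection_matrix S"
    and "sym_pos_def \<Gamma>prior"
    and "sym_pos_def \<Gamma>noise"
    and "u \<noteq> 0"
    and "y = transpose S *v u + \<eta>"
    and "D = \<Phi> ** Gamma_post \<Phi> S \<Gamma>prior \<Gamma>noise ** transpose (transpose S ** \<Phi>)
               ** matrix_inv \<Gamma>noise ** transpose S"
  shows "norm (u_MAP \<Phi> S \<Gamma>prior \<Gamma>noise y - u) / norm u
    \<le> spectral_norm (D - mat 1)
      + spectral_norm (Gamma_post \<Phi> S \<Gamma>prior \<Gamma>noise ** transpose (transpose S ** \<Phi>)
          ** matrix_inv \<Gamma>noise) * (norm \<eta> / norm u)"
proof -
  define B where "B = Gamma_post \<Phi> S \<Gamma>prior \<Gamma>noise ** transpose (transpose S ** \<Phi>)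
    ** matrix_inv \<Gamma>noise"
  have D: "D = \<Phi> ** B ** transpose S"
    by (simp add: assms(7) B_def matrix_mul_assoc)
  have MAP: "u_MAP \<Phi> S \<Gamma>prior \<Gamma>noise y = (\<Phi> ** B) *v y"
    by (simp add: u_MAP_def B_def matrix_mul_assoc)
  have "u_MAP \<Phi> S \<Gamma>prior \<Gamma>noise y - u = (D - mat 1) *v u + \<Phi> *v (B *v \<eta>)"
    unfolding MAP unfolding D assms(6)
    by (simp add: matrix_vector_right_distrib matrix_vector_mult_diff_rdistrib
        matrix_vector_mul_assoc del: transpose_matrix_vector)
  then have "norm (u_MAP \<Phi> S \<Gamma>prior \<Gamma>noise y - u)
      \<le> norm ((D - mat 1) *v u) + norm (\<Phi> *v (B *v \<eta>))"
    by (simp add: norm_triangle_ineq)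
  also have "\<dots> = norm ((D - mat 1) *v u) + norm (B *v \<eta>)"
    by (simp add: norm_orthonormal_columns_mult[OF assms(1)])
  also have "\<dots> \<le> spectral_norm (D - mat 1) * norm u + spectral_norm B * norm \<eta>"
    by (intro add_mono norm_matrix_vector_le_spectral_norm)
  finally show ?thesis
    using assms(5) by (simp add: B_def[symmetric] field_simps)
qed

end
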